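(* Let $N\ge 2$ be an integer, $s\in(1,2)$, $\sigma=s-1$, $p\in(1,\frac{N}{s})$ and $a\in[0,\frac{N-sp}{2})$. Put $p^\star=\frac{Np}{N-sp-2a}$ and $p^*_s=\frac{Np}{N-sp}$. Then $$L^{p^\star,p}(\mathbb{R}^N)\subsetneq L_a^{p^*_s}(\mathbb{R}^N).$$
   Context: Weighted Lebesgue space: $L_a^{p^*_s}(\mathbb{R}^N)$ is the space of measurable $u$ with $$\|u\|_{L_a^{p^*_s}(\mathbb{R}^N)}:=\left(\int_{\mathbb{R}^N}\frac{|u(x)|^{p^*_s}}{|x|^{2ap^*_s/p}}\,dx\right)^{1/p^*_s}<\infty .$$ Lorentz space: for a measurable $f$ finite a.e. on $\mathbb{R}^N$, let $\mu_f(t)=|\{x\in\mathbb{R}^N:|f(x)|>t\}|$ (Lebesgue measure) for $t>0$. For $P,q\in(0,\infty)$, $$|f|_{P,q}:=\left(P\int_0^\infty t^{q-1}\mu_f(t)^{q/P}\,dt\right)^{1/q},$$ and $L^{P,q}(\mathbb{R}^N)$ is the set of such $f$ with $|f|_{P,q}<\infty$. *)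

theory Defs
  imports "HOL-Analysis.Analysis"
begin

(* Real powers of extended nonnegative reals; only meant for exponents r > 0,
   where \<infinity> to the power r is \<infinity>. *)
definition ennreal_powr :: "ennreal \<Rightarrow> real \<Rightarrow> ennreal" where
  "ennreal_powr x r = (if x = \<infinity> then \<infinity> else ennreal (enn2real x powr r))"

(* The integrand takes the value 0 at the origin (division by zero, or 0 powr 0 in the
   denominator when a = 0); the origin is a null set, so this does not affect the integral. *)
definition weighted_Lebesgue_norm ::
    "real \<Rightarrow> real \<Rightarrow> real \<Rightarrow> ('a::euclidean_space \<Rightarrow> real) \<Rightarrow> ennreal" where
  "weighted_Lebesgue_norm a p r u =
     ennreal_powr
       (\<integral>\<^sup>+ x. ennreal (\<bar>u x\<bar> powr r / norm x powr (2 * a * r / p)) \<partial>lebesgue)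
       (1 / r)"

(* The spaces below consist of functions rather than of classes modulo equality almost
   everywhere; membership only depends on the class. Since functions are real-valued,
   finiteness almost everywhere is automatic. *)
definition weighted_Lebesgue_space ::
    "real \<Rightarrow> real \<Rightarrow> real \<Rightarrow> ('a::euclidean_space \<Rightarrow> real) set" where
  "weighted_Lebesgue_space a p r =
     {u. u \<in> borel_measurable lebesgue \<and> weighted_Lebesgue_norm a p r u < \<infinity>}"

definition distribution_function :: "('a::euclidean_space \<Rightarrow> real) \<Rightarrow> real \<Rightarrow> ennreal" where
  "distribution_function f t = emeasure lebesgue {x. \<bar>f x\<bar> > t}"

definition Lorentz_norm ::
    "real \<Rightarrow> real \<Rightarrow> ('a::euclidean_space \<Rightarrow> real) \<Rightarrow> ennreal" where
  "Lorentz_norm P q f =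
     ennreal_powr
       (ennreal P *
         (\<integral>\<^sup>+ t\<in>{0<..}. ennreal (t powr (q - 1)) *
            ennreal_powr (distribution_function f t) (q / P) \<partial>lborel))
       (1 / q)"

definition Lorentz_space :: "real \<Rightarrow> real \<Rightarrow> ('a::euclidean_space \<Rightarrow> real) set" where
  "Lorentz_space P q =
     {f. f \<in> borel_measurable lebesgue \<and> Lorentz_norm P q f < \<infinity>}"

end

theory Submission
  imports Defs
begin

text \<open>
  With \<open>n\<close> the dimension, \<open>r = p_star_s\<close> and \<open>b = 2 * a * r / p < n\<close>, one has
  \<open>p_star = r / (1 - b / n)\<close>. The weight \<open>|x| powr (- b)\<close> gives a set \<open>E\<close> at most a constant
  times the mass \<open>|E| powr (1 - b / n)\<close>, so the layer cake formula bounds the weighted \<open>L\<^sup>r\<close>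
  integral by the Lorentz integral with exponents \<open>(p_star, r)\<close>; a Chebyshev bound embeds the
  Lorentz space with second exponent \<open>p < r\<close> into the one with second exponent \<open>r\<close>.
  The inclusion is strict because of the function with value
  \<open>2 powr (- k * n / p_star) * (k + 1) powr (- 1 / p)\<close> on the annulus
  \<open>2 ^ k \<le> |x| < 2 ^ (k + 1)\<close>: its weighted integral is comparable to the sum of
  \<open>(k + 1) powr (- r / p)\<close>, but its Lorentz integral dominates the harmonic series.
\<close>

section \<open>Extended real powers and Lebesgue measure\<close>

lemma ennreal_powr_ennreal [simp]: "x \<ge> 0 \<Longrightarrow> ennreal_powr (ennreal x) r = ennreal (x powr r)"
  by (simp add: ennreal_powr_def)

lemma ennreal_powr_less_top_iff [simp]: "ennreal_powr x r < top \<longleftrightarrow> x < top"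
  by (auto simp: ennreal_powr_def less_top)

lemma ennreal_powr_mono:
  assumes "x \<le> y" and "r \<ge> 0"
  shows "ennreal_powr x r \<le> ennreal_powr y r"
proof (cases "y = \<infinity>")
  case False
  then have "x \<noteq> \<infinity>" "enn2real x \<le> enn2real y"
    using assms by (auto simp: enn2real_mono less_top top_unique)
  moreover from this have "enn2real x powr r \<le> enn2real y powr r"
    using assms by (intro powr_mono2) auto
  ultimately show ?thesis
    using False by (simp add: ennreal_powr_def ennreal_leI)
qed (simp add: ennreal_powr_def)

lemma measurable_ennreal_powr [measurable]: "(\<lambda>x. ennreal_powr x r) \<in> borel_measurable borel"
  unfolding ennreal_powr_def by measurable

text \<open>Completion keeps the measure of Borel sets, so a countable cover for
  \<open>lborel\<close> serves here too. This is what permits Fubini over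
  \<open>lebesgue\<close>.\<close>

lemma sigma_finite_lebesgue: "sigma_finite_measure (lebesgue :: 'a::euclidean_space measure)"
proof -
  obtain A :: "'a set set" where "countable A" "A \<subseteq> sets lborel" "\<Union>A = space lborel"
      "\<forall>a\<in>A. emeasure lborel a \<noteq> \<infinity>"
    using lborel.sigma_finite_countable by blast
  then show ?thesis
    by (intro sigma_finite_measure.intro exI[of _ A]) (auto simp: subset_eq)
qed

lemma emeasure_lebesgue_ball:
  assumes "r \<ge> 0"
  shows "emeasure lebesgue (ball c r :: 'a::euclidean_space set)
           = ennreal (unit_ball_vol (DIM('a)) * r ^ DIM('a))"
  using emeasure_ball[OF assms, of c] by simp

section \<open>Power integrals and the layer cake formula\<close>

lemma nn_integral_powr_Ioo:
  assumes "a \<ge> 0" and "r > 0"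
  shows "(\<integral>\<^sup>+t\<in>{0<..<a}. ennreal (t powr (r - 1)) \<partial>lborel) = ennreal (a powr r / r)"
proof -
  have "(\<integral>\<^sup>+t\<in>{0<..<a}. ennreal (t powr (r - 1)) \<partial>lborel)
      = (\<integral>\<^sup>+t\<in>{0..a}. ennreal (t powr (r - 1)) \<partial>lborel)"
  proof (rule nn_integral_cong_AE)
    show "AE t in lborel. ennreal (t powr (r - 1)) * indicator {0<..<a} t
        = ennreal (t powr (r - 1)) * indicator {0..a} t"
      using AE_lborel_singleton[of 0] AE_lborel_singleton[of a]
      by eventually_elim (auto simp: indicator_def)
  qed
  also have "\<dots> = ennreal (a powr r / r)"
    using nn_integral_has_integral_lebesgue'[OF _ has_integral_powr_from_0[of "r - 1" a]] assms by simp
  finally show ?thesis .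
qed

text \<open>Write \<open>f x powr r\<close> as the integral of \<open>r * t powr (r - 1)\<close>
  over \<open>0 < t < f x\<close> and swap the integrals. The factor \<open>w\<close> lets the
  formula serve twice: with \<open>f\<close> the singular weight and \<open>w\<close> an indicator,
  and with \<open>f\<close> the modulus of a function and \<open>w\<close> the weight.\<close>

lemma nn_integral_layer_cake:
  fixes f :: "'a \<Rightarrow> real" and w :: "'a \<Rightarrow> ennreal"
  assumes "sigma_finite_measure M"
    and [measurable]: "f \<in> borel_measurable M" "w \<in> borel_measurable M"
    and f: "\<And>x. f x \<ge> 0" and r: "r > 0"
  shows "(\<integral>\<^sup>+x. ennreal (f x powr r) * w x \<partial>M)
       = (\<integral>\<^sup>+t\<in>{0<..}. ennreal (r * t powr (r - 1)) * (\<integral>\<^sup>+x. w x * indicator {x. t < f x} x \<partial>M) \<partial>lborel)"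
proof -
  interpret sigma_finite_measure M by fact
  interpret pair_sigma_finite M lborel ..
  have "(\<integral>\<^sup>+x. ennreal (f x powr r) * w x \<partial>M)
      = (\<integral>\<^sup>+x. (\<integral>\<^sup>+t. ennreal (r * t powr (r - 1)) * w x * indicator {0<..<f x} t \<partial>lborel) \<partial>M)"
  proof (intro nn_integral_cong)
    fix x
    have "(\<integral>\<^sup>+t. ennreal (r * t powr (r - 1)) * w x * indicator {0<..<f x} t \<partial>lborel)
        = (\<integral>\<^sup>+t. (ennreal r * w x) * (ennreal (t powr (r - 1)) * indicator {0<..<f x} t) \<partial>lborel)"
      using r by (intro nn_integral_cong) (simp add: ennreal_mult mult_ac)
    also have "\<dots> = ennreal r * w x * ennreal (f x powr r / r)"
      using f r by (simp add: nn_integral_cmult nn_integral_powr_Ioo)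
    also have "\<dots> = ennreal (r * (f x powr r / r)) * w x"
      using r by (subst ennreal_mult) (auto simp: mult_ac)
    finally show "ennreal (f x powr r) * w x
        = (\<integral>\<^sup>+t. ennreal (r * t powr (r - 1)) * w x * indicator {0<..<f x} t \<partial>lborel)"
      using r by simp
  qed
  \<comment> \<open>Reading the indicator as that of one Borel set of pairs, evaluated at
    \<open>(t, f x)\<close>, makes the integrand jointly measurable, as Fubini requires.\<close>
  also have "\<dots> = (\<integral>\<^sup>+x. (\<integral>\<^sup>+t. ennreal (r * t powr (r - 1)) * w x * indicator {y. 0 < fst y \<and> fst y < snd y} (t, f x) \<partial>lborel) \<partial>M)"
    by (intro nn_integral_cong) (auto simp: indicator_def)
  also have "\<dots> = (\<integral>\<^sup>+t. (\<integral>\<^sup>+x. ennreal (r * t powr (r - 1)) * w x * indicator {y. 0 < fst y \<and> fst y < snd y} (t, f x) \<partial>M) \<partial>lborel)"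
    by (rule Fubini'[symmetric]) measurable
  also have "\<dots> = (\<integral>\<^sup>+t\<in>{0<..}. ennreal (r * t powr (r - 1)) * (\<integral>\<^sup>+x. w x * indicator {x. t < f x} x \<partial>M) \<partial>lborel)"
  proof (intro nn_integral_cong)
    fix t
    have "(\<integral>\<^sup>+x. ennreal (r * t powr (r - 1)) * w x * indicator {y. 0 < fst y \<and> fst y < snd y} (t, f x) \<partial>M)
        = (\<integral>\<^sup>+x. (ennreal (r * t powr (r - 1)) * indicator {0<..} t) * (w x * indicator {x. t < f x} x) \<partial>M)"
      by (intro nn_integral_cong) (auto simp: indicator_def)
    also have "\<dots> = (ennreal (r * t powr (r - 1)) * indicator {0<..} t) * (\<integral>\<^sup>+x. w x * indicator {x. t < f x} x \<partial>M)"
      by (rule nn_integral_cmult) measurable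
    finally show "(\<integral>\<^sup>+x. ennreal (r * t powr (r - 1)) * w x * indicator {y. 0 < fst y \<and> fst y < snd y} (t, f x) \<partial>M)
        = ennreal (r * t powr (r - 1)) * (\<integral>\<^sup>+x. w x * indicator {x. t < f x} x \<partial>M) * indicator {0<..} t"
      by (simp add: mult_ac)
  qed
  finally show ?thesis .
qed

section \<open>Mass of a set under the singular weight\<close>

text \<open>The part of \<open>E\<close> where the weight exceeds \<open>t\<close> is bounded in
  measure both by that of \<open>E\<close> and by the volume of a ball of radius
  \<open>t powr (- 1 / b)\<close>. The smaller of the two is integrable in \<open>t\<close> because
  \<open>n / b > 1\<close>, and splitting where they balance gives the power
  \<open>1 - b / n\<close>.\<close>

lemma nn_integral_weight_le:
  fixes b :: real
  assumes b: "0 \<le> b" "b < DIM('a::euclidean_space)"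
  obtains C where "C > 0"
    "\<And>E :: 'a set. E \<in> sets lebesgue \<Longrightarrow>
      (\<integral>\<^sup>+x\<in>E. ennreal (1 / norm x powr b) \<partial>lebesgue)
        \<le> ennreal C * ennreal_powr (emeasure lebesgue E) (1 - b / DIM('a))"
proof (cases "b = 0")
  \<comment> \<open>The radius \<open>t powr (- 1 / b)\<close> makes no sense here. The weight is 1
    off the origin and 0 at it, as \<open>0 powr 0 = 0\<close>, hence at most 1.\<close>
  case True
  show ?thesis
  proof (rule that[of 1])
    fix E :: "'a set" assume "E \<in> sets lebesgue"
    have "(\<integral>\<^sup>+x\<in>E. ennreal (1 / norm x powr b) \<partial>lebesgue) \<le> (\<integral>\<^sup>+x. indicator E x \<partial>lebesgue)"
      using True by (intro nn_integral_mono) (auto simp: indicator_def)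
    also have "\<dots> = emeasure lebesgue E"
      using \<open>E \<in> sets lebesgue\<close> by simp
    also have "\<dots> \<le> ennreal 1 * ennreal_powr (emeasure lebesgue E) (1 - b / DIM('a))"
      using True by (cases "emeasure lebesgue E") (auto simp: ennreal_powr_def)
    finally show "(\<integral>\<^sup>+x\<in>E. ennreal (1 / norm x powr b) \<partial>lebesgue)
        \<le> ennreal 1 * ennreal_powr (emeasure lebesgue E) (1 - b / DIM('a))" .
  qed simp
next
  case False
  define n where "n = real DIM('a)"
  define \<omega> where "\<omega> = unit_ball_vol (DIM('a))"
  \<comment> \<open>The summand 1 will account for heights up to a cut \<open>T\<close>, the other
    one for the tail integral of \<open>\<omega> * t powr (- n / b)\<close> beyond it.\<close>
  define C where "C = 1 + \<omega> / (n / b - 1)"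
  have n: "n > 0" "b > 0" "b < n" "n / b - 1 > 0"
    using b False by (auto simp: n_def field_simps)
  have \<omega>: "\<omega> > 0" by (simp add: \<omega>_def)
  show ?thesis
  proof (rule that[of C])
    show "C > 0" using n \<omega> by (auto simp: C_def add_pos_pos)
    fix E :: "'a set" assume E [measurable]: "E \<in> sets lebesgue"
    have [measurable]: "(\<lambda>x::'a. 1 / norm x powr b) \<in> borel_measurable lebesgue"
      by (intro measurable_completion) measurable
    let ?I = "\<integral>\<^sup>+x\<in>E. ennreal (1 / norm x powr b) \<partial>lebesgue"
    \<comment> \<open>Only a measure that is positive and finite yields a positive cut height with a
      convergent tail.\<close>
    consider "emeasure lebesgue E = 0" | "emeasure lebesgue E = \<infinity>"
      | \<mu> where "emeasure lebesgue E = ennreal \<mu>" "\<mu> > 0"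
      by (cases "emeasure lebesgue E") (auto simp: less_le)
    then show "?I \<le> ennreal C * ennreal_powr (emeasure lebesgue E) (1 - b / DIM('a))"
    proof cases
      case 1
      then have "AE x in lebesgue. x \<notin> E"
        by (auto intro!: AE_I[of _ _ E])
      then have "?I = integral\<^sup>N (lebesgue :: 'a measure) (\<lambda>_. 0)"
        by (intro nn_integral_cong_AE) (auto simp: indicator_def)
      then show ?thesis by simp
    next
      case 2
      then show ?thesis using \<open>C > 0\<close> by (simp add: ennreal_powr_def ennreal_mult_top)
    next
      case (3 \<mu>)
      \<comment> \<open>the height below which the bound \<open>\<mu>\<close> on the superlevel sets beats that by the ball volume (up to \<open>\<omega>\<close>)\<close>
      define T where "T = \<mu> powr (- b / n)"
      have T: "T > 0" using 3 by (simp add: T_def)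
      have layer: "(\<integral>\<^sup>+x. indicator E x * indicator {x. t < 1 / norm x powr b} x \<partial>lebesgue)
          \<le> (if t \<le> T then ennreal \<mu> else ennreal (\<omega> * t powr (- n / b)))" if t: "t > 0" for t
      proof -
        have meas: "{x \<in> space lebesgue. t < 1 / norm x powr b} \<in> sets (lebesgue :: 'a measure)"
          by measurable
        \<comment> \<open>The origin lies outside the set on the left, since division by zero makes
          the weight 0 there.\<close>
        have sub: "{x::'a. t < 1 / norm x powr b} \<subseteq> ball 0 (t powr (- 1 / b))"
        proof clarify
          fix x :: 'a assume x: "t < 1 / norm x powr b"
          then have "norm x > 0" using t by (cases "x = 0") auto
          then have "norm x powr b < 1 / t" using x t by (simp add: field_simps)
          then have "(norm x powr b) powr (1 / b) < (1 / t) powr (1 / b)"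
            using n by (intro powr_less_mono2) auto
          then have "norm x < t powr (- 1 / b)"
            using n t by (simp add: powr_powr powr_divide powr_minus_divide)
          then show "x \<in> ball 0 (t powr (- 1 / b))" by simp
        qed
        have "(\<integral>\<^sup>+x. indicator E x * indicator {x. t < 1 / norm x powr b} x \<partial>lebesgue)
            = emeasure lebesgue (E \<inter> {x. t < 1 / norm x powr b})"
          unfolding indicator_inter_arith[symmetric]
          by (rule nn_integral_indicator) (use meas in auto)
        moreover have "emeasure lebesgue (E \<inter> {x. t < 1 / norm x powr b}) \<le> ennreal \<mu>"
          using 3 by (metis E Int_lower1 emeasure_mono)
        moreover have "emeasure lebesgue (E \<inter> {x. t < 1 / norm x powr b})
            \<le> ennreal (\<omega> * (t powr (- 1 / b)) ^ DIM('a))"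
          using emeasure_mono[of "E \<inter> {x. t < 1 / norm x powr b}" "ball 0 (t powr (- 1 / b))" lebesgue] sub
          by (auto simp: emeasure_lebesgue_ball \<omega>_def simp del: emeasure_completion)
        moreover have "(t powr (- 1 / b)) ^ DIM('a) = t powr (- n / b)"
          using t by (simp add: powr_realpow[symmetric] powr_powr n_def)
        ultimately show ?thesis
          by (simp del: emeasure_completion)
      qed
      have "?I = (\<integral>\<^sup>+x. ennreal ((1 / norm x powr b) powr 1) * indicator E x \<partial>lebesgue)"
        by simp
      also have "\<dots> = (\<integral>\<^sup>+t\<in>{0<..}. ennreal (1 * t powr (1 - 1)) *
          (\<integral>\<^sup>+x. indicator E x * indicator {x. t < 1 / norm x powr b} x \<partial>lebesgue) \<partial>lborel)"
        by (rule nn_integral_layer_cake[OF sigma_finite_lebesgue]) auto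
      \<comment> \<open>Splitting the heights at \<open>T\<close> into an open interval and a closed
        half-line fits the two power integrals used below. The first bound is also used at
        \<open>T\<close> itself, which costs a term on the null set \<open>{T}\<close>.\<close>
      also have "\<dots> \<le> (\<integral>\<^sup>+t. ennreal \<mu> * (ennreal (t powr (1 - 1)) * indicator {0<..<T} t) +
           (ennreal \<mu> * indicator {T} t + ennreal \<omega> * (ennreal (t powr (- n / b)) * indicator {T..} t)) \<partial>lborel)"
      proof (rule nn_integral_mono)
        fix t :: real
        show "ennreal (1 * t powr (1 - 1))
            * (\<integral>\<^sup>+x. indicator E x * indicator {x. t < 1 / norm x powr b} x \<partial>lebesgue) * indicator {0<..} t
          \<le> ennreal \<mu> * (ennreal (t powr (1 - 1)) * indicator {0<..<T} t) +
             (ennreal \<mu> * indicator {T} t + ennreal \<omega> * (ennreal (t powr (- n / b)) * indicator {T..} t))"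
        proof (cases "t > 0")
          case True
          have "(\<integral>\<^sup>+x. indicator E x * indicator {x. t < 1 / norm x powr b} x \<partial>lebesgue)
              \<le> ennreal \<mu> * indicator {0<..<T} t + (ennreal \<mu> * indicator {T} t + ennreal \<omega> * (ennreal (t powr (- n / b)) * indicator {T..} t))"
            using True \<omega> by (intro order.trans[OF layer[OF True]]) (auto simp: indicator_def ennreal_mult)
          then show ?thesis using True by simp
        qed simp
      qed
      also have "\<dots> = ennreal \<mu> * (\<integral>\<^sup>+t\<in>{0<..<T}. ennreal (t powr (1 - 1)) \<partial>lborel) +
           ennreal \<omega> * (\<integral>\<^sup>+t\<in>{T..}. ennreal (t powr (- n / b)) \<partial>lborel)"
        by (simp add: nn_integral_add nn_integral_cmult)
      also have "(\<integral>\<^sup>+t\<in>{0<..<T}. ennreal (t powr (1 - 1)) \<partial>lborel) = ennreal T"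
        using nn_integral_powr_Ioo[of T 1] T by simp
      also have "(\<integral>\<^sup>+t\<in>{T..}. ennreal (t powr (- n / b)) \<partial>lborel)
          = ennreal (T powr (1 - n / b) / (n / b - 1))"
      proof (rule nn_integral_has_integral_lebesgue')
        have exponent: "- n / b + 1 = - (n / b - 1)" "1 - n / b = - (n / b - 1)"
          by simp_all
        have "- n / b < - 1"
          using n(4) by simp
        from has_integral_powr_to_inf[OF this T]
        show "((\<lambda>t. t powr (- n / b)) has_integral T powr (1 - n / b) / (n / b - 1)) {T..}"
          unfolding exponent minus_divide_divide .
      qed simp
      also have "T powr (1 - n / b) = \<mu> powr (1 - b / n)"
      proof -
        have "- b / n * (1 - n / b) = 1 - b / n"
          using n by (simp add: field_simps)
        then show ?thesis by (simp only: T_def powr_powr)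
      qed
      also have "ennreal \<mu> * ennreal T + ennreal \<omega> * ennreal (\<mu> powr (1 - b / n) / (n / b - 1))
          = ennreal (\<mu> * T + \<omega> * (\<mu> powr (1 - b / n) / (n / b - 1)))"
        using n 3 T \<omega> by (simp add: ennreal_mult[symmetric] ennreal_plus[symmetric] del: ennreal_plus)
      also have "\<mu> * T = \<mu> powr (1 - b / n)"
        using 3 by (simp add: T_def powr_diff powr_minus_divide)
      also have "\<mu> powr (1 - b / n) + \<omega> * (\<mu> powr (1 - b / n) / (n / b - 1)) = C * \<mu> powr (1 - b / n)"
        by (simp add: C_def algebra_simps)
      finally show ?thesis
        using 3 \<open>C > 0\<close> by (simp add: n_def ennreal_mult)
    qed
  qed
qed

section \<open>Raising the second Lorentz exponent\<close>

text \<open>Finiteness for \<open>q\<close> together with monotonicity gives a uniform bound on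
  \<open>t powr q * m t powr (q / P)\<close>. The integrand for \<open>r\<close> is the one for
  \<open>q\<close> times the power \<open>(r - q) / q\<close> of this bounded quantity.\<close>

lemma nn_integral_Lorentz_exponent_mono:
  fixes m :: "real \<Rightarrow> ennreal"
  assumes antimono: "\<And>t t'. 0 < t \<Longrightarrow> t \<le> t' \<Longrightarrow> m t' \<le> m t"
    and [measurable]: "m \<in> borel_measurable borel"
    and P: "P > 0" and q: "0 < q" "q < r"
    and fin: "(\<integral>\<^sup>+t\<in>{0<..}. ennreal (t powr (q - 1)) * ennreal_powr (m t) (q / P) \<partial>lborel) < \<infinity>"
  shows "(\<integral>\<^sup>+t\<in>{0<..}. ennreal (t powr (r - 1)) * ennreal_powr (m t) (r / P) \<partial>lborel) < \<infinity>"
proof -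
  let ?I = "\<lambda>r. \<integral>\<^sup>+t\<in>{0<..}. ennreal (t powr (r - 1)) * ennreal_powr (m t) (r / P) \<partial>lborel"
  obtain A where A: "?I q = ennreal A" "A \<ge> 0"
    using fin by (cases "?I q") auto
  \<comment> \<open>Chebyshev: on \<open>0 < \<tau> < t\<close> the value \<open>m \<tau>\<close> is
    at least \<open>m t\<close>, so the integral over this interval alone already gives the
    left-hand side.\<close>
  have weak: "ennreal (t powr q / q) * ennreal_powr (m t) (q / P) \<le> ennreal A" if t: "t > 0" for t
  proof -
    have "ennreal (t powr q / q) * ennreal_powr (m t) (q / P)
        = (\<integral>\<^sup>+\<tau>. ennreal (\<tau> powr (q - 1)) * indicator {0<..<t} \<tau> * ennreal_powr (m t) (q / P) \<partial>lborel)"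
      using t q by (simp add: nn_integral_multc nn_integral_powr_Ioo)
    also have "\<dots> \<le> ?I q"
    proof (rule nn_integral_mono)
      fix \<tau> :: real
      show "ennreal (\<tau> powr (q - 1)) * indicator {0<..<t} \<tau> * ennreal_powr (m t) (q / P)
          \<le> ennreal (\<tau> powr (q - 1)) * ennreal_powr (m \<tau>) (q / P) * indicator {0<..} \<tau>"
      proof (cases "0 < \<tau> \<and> \<tau> < t")
        case True
        then have "ennreal_powr (m t) (q / P) \<le> ennreal_powr (m \<tau>) (q / P)"
          using P q by (intro ennreal_powr_mono antimono) auto
        then show ?thesis
          using True by (simp add: mult_left_mono)
      qed simp
    qed
    finally show ?thesis using A by simp
  qed
  define M where "M t = enn2real (m t)" for t
  \<comment> \<open>An infinite value of \<open>m t\<close> would make the left side of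
    \<open>weak\<close> infinite; from here on the estimate can be carried out in the reals.\<close>
  have m: "m t = ennreal (M t)" if "t > 0" for t
  proof -
    have "m t \<noteq> \<infinity>"
      using weak[OF that] that q by (auto simp: ennreal_powr_def ennreal_mult_top top_unique)
    then show ?thesis by (simp add: M_def less_top)
  qed
  have [simp]: "M t \<ge> 0" for t by (simp add: M_def)
  \<comment> \<open>The weak bound \<open>q * A\<close>, raised to the power that turns the
    exponents \<open>q\<close> and \<open>q / P\<close> into \<open>r - q\<close> and
    \<open>(r - q) / P\<close>.\<close>
  define K where "K = (q * A) powr ((r - q) / q)"
  have le: "t powr (r - 1) * M t powr (r / P) \<le> K * (t powr (q - 1) * M t powr (q / P))"
    if t: "t > 0" for t
  proof -
    have "t powr q / q * M t powr (q / P) \<le> A"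
      using weak[OF t] m[OF t] t q A by (simp add: ennreal_mult[symmetric])
    then have "t powr q * M t powr (q / P) \<le> q * A"
      using q by (simp add: field_simps)
    then have "(t powr q * M t powr (q / P)) powr ((r - q) / q) \<le> K"
      unfolding K_def using q by (intro powr_mono2) auto
    moreover have "q * ((r - q) / q) = r - q" "q / P * ((r - q) / q) = (r - q) / P"
      using q by simp_all
    ultimately have *: "t powr (r - q) * M t powr ((r - q) / P) \<le> K"
      by (simp only: powr_mult powr_powr)
    have "r - 1 = (r - q) + (q - 1)" "r / P = (r - q) / P + q / P"
      using P by (simp_all add: field_simps)
    then have "t powr (r - 1) * M t powr (r / P)
        = (t powr (r - q) * M t powr ((r - q) / P)) * (t powr (q - 1) * M t powr (q / P))"
      by (simp only: powr_add) (simp add: mult_ac)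
    also have "\<dots> \<le> K * (t powr (q - 1) * M t powr (q / P))"
      using * by (rule mult_right_mono) simp
    finally show ?thesis .
  qed
  have "?I r \<le> (\<integral>\<^sup>+t. ennreal K * (ennreal (t powr (q - 1)) * ennreal_powr (m t) (q / P) * indicator {0<..} t) \<partial>lborel)"
  proof (rule nn_integral_mono)
    fix t :: real
    show "ennreal (t powr (r - 1)) * ennreal_powr (m t) (r / P) * indicator {0<..} t
        \<le> ennreal K * (ennreal (t powr (q - 1)) * ennreal_powr (m t) (q / P) * indicator {0<..} t)"
    proof (cases "t > 0")
      case True
      have "K \<ge> 0" by (simp add: K_def)
      with le[OF True] show ?thesis
        using True by (simp add: m ennreal_mult[symmetric] ennreal_leI)
    qed simp
  qed
  also have "\<dots> = ennreal K * ennreal A"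
    unfolding A(1)[symmetric] by (rule nn_integral_cmult) measurable
  also have "\<dots> < \<infinity>"
    by (simp add: ennreal_mult_less_top)
  finally show ?thesis .
qed

section \<open>Distribution functions and the inclusion of the spaces\<close>

lemma distribution_function_antimono:
  assumes [measurable]: "f \<in> borel_measurable lebesgue" and "t \<le> t'"
  shows "distribution_function f t' \<le> distribution_function f t"
proof -
  have "{x \<in> space lebesgue. t < \<bar>f x\<bar>} \<in> sets lebesgue" by measurable
  then show ?thesis
    unfolding distribution_function_def using assms(2) by (intro emeasure_mono) auto
qed

text \<open>The distribution function is a parameter integral of a jointly measurable indicator over
  a sigma-finite measure.\<close>

lemma measurable_distribution_function:
  fixes f :: "'a::euclidean_space \<Rightarrow> real"
  assumes [measurable]: "f \<in> borel_measurable lebesgue"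
  shows "distribution_function f \<in> borel_measurable borel"
proof -
  interpret sigma_finite_measure "lebesgue :: 'a measure" by (rule sigma_finite_lebesgue)
  have "distribution_function f t = (\<integral>\<^sup>+x. indicator {y. fst y < snd y} (t, \<bar>f x\<bar>) \<partial>lebesgue)" for t
  proof -
    have "{x \<in> space lebesgue. t < \<bar>f x\<bar>} \<in> sets lebesgue" by measurable
    then have "distribution_function f t = (\<integral>\<^sup>+x. indicator {x. t < \<bar>f x\<bar>} x \<partial>lebesgue)"
      unfolding distribution_function_def by (intro nn_integral_indicator[symmetric]) simp
    also have "\<dots> = (\<integral>\<^sup>+x. indicator {y. fst y < snd y} (t, \<bar>f x\<bar>) \<partial>lebesgue)"
      by (intro nn_integral_cong) (simp add: indicator_def)
    finally show ?thesis .
  qed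
  moreover have "(\<lambda>t. \<integral>\<^sup>+x. indicator {y. fst y < snd y} (t, \<bar>f x\<bar>) \<partial>lebesgue) \<in> borel_measurable borel"
    by measurable
  ultimately show ?thesis by (simp cong: measurable_cong)
qed

lemma Lorentz_space_iff:
  assumes "P > 0"
  shows "f \<in> Lorentz_space P q \<longleftrightarrow> f \<in> borel_measurable lebesgue \<and>
    (\<integral>\<^sup>+t\<in>{0<..}. ennreal (t powr (q - 1)) * ennreal_powr (distribution_function f t) (q / P) \<partial>lborel) < \<infinity>"
  using assms by (auto simp: Lorentz_space_def Lorentz_norm_def ennreal_mult_less_top)

text \<open>The choice of \<open>P\<close> means \<open>1 - b / n = r / P\<close>, with
  \<open>n\<close> the dimension. The weight bound on a superlevel set of \<open>u\<close> is then a
  constant times the power \<open>r / P\<close> of the distribution function, exactly as in the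
  Lorentz integral with exponents \<open>P\<close> and \<open>r\<close>.\<close>

lemma Lorentz_space_subset_weighted_Lebesgue_space:
  fixes a p q r :: real
  assumes b: "b = 2 * a * r / p" "0 \<le> b" "b < DIM('a)" and q: "0 < q" "q < r"
    and P: "P = r / (1 - b / DIM('a))"
  shows "(Lorentz_space P q :: ('a::euclidean_space \<Rightarrow> real) set) \<subseteq> weighted_Lebesgue_space a p r"
proof
  fix u :: "'a \<Rightarrow> real"
  assume u: "u \<in> Lorentz_space P q"
  have "P > 0" and rP: "1 - b / DIM('a) = r / P"
    using b(2,3) q by (simp_all add: P)
  have meas [measurable]: "u \<in> borel_measurable lebesgue"
    and fin: "(\<integral>\<^sup>+t\<in>{0<..}. ennreal (t powr (q - 1)) * ennreal_powr (distribution_function u t) (q / P) \<partial>lborel) < \<infinity>"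
    using u \<open>P > 0\<close> by (auto simp: Lorentz_space_iff)
  note [measurable] = measurable_distribution_function[OF meas]
  have [measurable]: "(\<lambda>x::'a. 1 / norm x powr b) \<in> borel_measurable lebesgue"
    by (intro measurable_completion) measurable
  obtain C where C: "C > 0" "\<And>E :: 'a set. E \<in> sets lebesgue \<Longrightarrow>
      (\<integral>\<^sup>+x\<in>E. ennreal (1 / norm x powr b) \<partial>lebesgue)
        \<le> ennreal C * ennreal_powr (emeasure lebesgue E) (1 - b / DIM('a))"
    using nn_integral_weight_le[OF b(2,3)] by metis
  have "(\<integral>\<^sup>+x. ennreal (\<bar>u x\<bar> powr r / norm x powr b) \<partial>lebesgue)
      = (\<integral>\<^sup>+x. ennreal (\<bar>u x\<bar> powr r) * ennreal (1 / norm x powr b) \<partial>lebesgue)"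
    by (intro nn_integral_cong) (simp add: ennreal_mult[symmetric])
  also have "\<dots> = (\<integral>\<^sup>+t\<in>{0<..}. ennreal (r * t powr (r - 1)) *
      (\<integral>\<^sup>+x. ennreal (1 / norm x powr b) * indicator {x. t < \<bar>u x\<bar>} x \<partial>lebesgue) \<partial>lborel)"
    using q by (intro nn_integral_layer_cake[OF sigma_finite_lebesgue]) auto
  also have "\<dots> \<le> (\<integral>\<^sup>+t. ennreal (r * C) *
      (ennreal (t powr (r - 1)) * ennreal_powr (distribution_function u t) (r / P) * indicator {0<..} t) \<partial>lborel)"
  proof (rule nn_integral_mono)
    fix t :: real
    have "{x \<in> space lebesgue. t < \<bar>u x\<bar>} \<in> sets lebesgue" by measurable
    then have "(\<integral>\<^sup>+x. ennreal (1 / norm x powr b) * indicator {x. t < \<bar>u x\<bar>} x \<partial>lebesgue)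
        \<le> ennreal C * ennreal_powr (distribution_function u t) (r / P)"
      unfolding distribution_function_def rP[symmetric] by (intro C) simp
    then have "ennreal (r * t powr (r - 1)) * (\<integral>\<^sup>+x. ennreal (1 / norm x powr b) * indicator {x. t < \<bar>u x\<bar>} x \<partial>lebesgue)
        * indicator {0<..} t
      \<le> ennreal (r * t powr (r - 1)) * (ennreal C * ennreal_powr (distribution_function u t) (r / P)) * indicator {0<..} t"
      by (intro mult_right_mono mult_left_mono) auto
    also have "\<dots> = ennreal (r * C) *
      (ennreal (t powr (r - 1)) * ennreal_powr (distribution_function u t) (r / P) * indicator {0<..} t)"
      using q C(1) by (simp add: ennreal_mult mult_ac)
    finally show "ennreal (r * t powr (r - 1)) * (\<integral>\<^sup>+x. ennreal (1 / norm x powr b) * indicator {x. t < \<bar>u x\<bar>} x \<partial>lebesgue)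
        * indicator {0<..} t \<le> ennreal (r * C) *
      (ennreal (t powr (r - 1)) * ennreal_powr (distribution_function u t) (r / P) * indicator {0<..} t)" .
  qed
  also have "\<dots> = ennreal (r * C) *
      (\<integral>\<^sup>+t\<in>{0<..}. ennreal (t powr (r - 1)) * ennreal_powr (distribution_function u t) (r / P) \<partial>lborel)"
    by (rule nn_integral_cmult) measurable
  \<comment> \<open>Here \<open>q < r\<close> enters: finiteness for the second exponent
    \<open>q\<close> passes to \<open>r\<close>.\<close>
  also have "\<dots> < \<infinity>"
    using nn_integral_Lorentz_exponent_mono[OF distribution_function_antimono[OF meas] _ \<open>P > 0\<close> q fin]
    by (simp add: ennreal_mult_less_top)
  finally show "u \<in> weighted_Lebesgue_space a p r"
    by (simp add: weighted_Lebesgue_space_def weighted_Lebesgue_norm_def b(1))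
qed

section \<open>Dyadic annuli and radial step functions\<close>

definition dyadic_annulus :: "nat \<Rightarrow> 'a::euclidean_space set" where
  "dyadic_annulus k = {x. 2 ^ k \<le> norm x \<and> norm x < 2 ^ Suc k}"

lemma dyadic_annulus_eq: "dyadic_annulus k = ball 0 (2 ^ Suc k) - ball 0 (2 ^ k)"
  by (auto simp: dyadic_annulus_def)

lemma sets_dyadic_annulus [measurable]: "dyadic_annulus k \<in> sets lebesgue"
  unfolding dyadic_annulus_eq by simp

text \<open>The volume is that of a difference of concentric balls. It is expressed with
  \<open>powr\<close> so that it combines with real exponents later.\<close>

lemma emeasure_dyadic_annulus:
  "emeasure lebesgue (dyadic_annulus k :: 'a::euclidean_space set)
     = ennreal (unit_ball_vol (DIM('a)) * (2 ^ DIM('a) - 1) * 2 powr (k * DIM('a)))"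
proof -
  have "emeasure lebesgue (dyadic_annulus k :: 'a set)
      = emeasure lebesgue (ball 0 (2 ^ Suc k) :: 'a set) - emeasure lebesgue (ball 0 (2 ^ k) :: 'a set)"
    unfolding dyadic_annulus_eq
    by (rule emeasure_Diff)
       (auto simp: emeasure_lebesgue_ball subset_ball simp del: emeasure_completion)
  also have "\<dots> = ennreal (unit_ball_vol (DIM('a)) * (2 ^ DIM('a) - 1) * (2 ^ k) ^ DIM('a))"
    by (simp add: emeasure_lebesgue_ball ennreal_minus algebra_simps power_mult_distrib
          del: emeasure_completion)
  also have "(2 ^ k) ^ DIM('a) = 2 powr (k * DIM('a))"
    by (simp add: powr_realpow[symmetric] powr_powr)
  finally show ?thesis .
qed

text \<open>The annulus index is read off as a floor of a logarithm, a closed formula from which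
  measurability is immediate. The value 0 on the unit ball keeps the function away from the
  singularity of the weight.\<close>

definition dyadic_step :: "(nat \<Rightarrow> real) \<Rightarrow> 'a::euclidean_space \<Rightarrow> real" where
  "dyadic_step c x = (if norm x < 1 then 0 else c (nat \<lfloor>log 2 (norm x)\<rfloor>))"

lemma measurable_dyadic_step [measurable]: "dyadic_step c \<in> borel_measurable lebesgue"
  unfolding dyadic_step_def by (intro measurable_completion) measurable

lemma norm_dyadic_annulus_ge_1: "x \<in> dyadic_annulus k \<Longrightarrow> norm x \<ge> 1"
  using order.trans[of 1 "2 ^ k" "norm x"] by (simp add: dyadic_annulus_def)

lemma floor_log_dyadic_annulus: "x \<in> dyadic_annulus k \<Longrightarrow> \<lfloor>log 2 (norm x)\<rfloor> = int k"
proof -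
  assume x: "x \<in> dyadic_annulus k"
  then have "norm x > 0"
    using norm_dyadic_annulus_ge_1[of x k] by linarith
  then show ?thesis
    using x by (subst floor_log_eq_powr_iff)
      (auto simp: dyadic_annulus_def powr_realpow powr_add mult.commute)
qed

lemma dyadic_step_annulus: "x \<in> dyadic_annulus k \<Longrightarrow> dyadic_step c x = c k"
  using norm_dyadic_annulus_ge_1[of x k] by (simp add: dyadic_step_def floor_log_dyadic_annulus)

lemma dyadic_annulus_cover:
  assumes "norm x \<ge> 1"
  obtains k where "x \<in> dyadic_annulus k"
proof -
  have "norm x > 0" using assms by linarith
  define j where "j = \<lfloor>log 2 (norm x)\<rfloor>"
  have "j \<ge> 0"
    unfolding j_def zero_le_floor by (subst zero_le_log_cancel_iff) (use \<open>norm x > 0\<close> assms in auto)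
  then obtain k where k: "j = int k" using nonneg_int_cases by blast
  have "2 powr k \<le> norm x \<and> norm x < 2 powr (k + 1)"
    using k floor_log_eq_powr_iff[of "norm x" 2 "int k"] \<open>norm x > 0\<close> by (simp add: j_def add.commute)
  then have "x \<in> dyadic_annulus k"
    by (simp add: dyadic_annulus_def powr_realpow powr_add mult.commute)
  then show ?thesis by (rule that)
qed

section \<open>Weighted and Lorentz integrals of step functions\<close>

lemma nn_integral_powr_Ico:
  assumes "0 < a" "a \<le> c" "r > 0"
  shows "(\<integral>\<^sup>+t\<in>{a..<c}. ennreal (t powr (r - 1)) \<partial>lborel) = ennreal ((c powr r - a powr r) / r)"
proof -
  let ?X = "\<integral>\<^sup>+t\<in>{a..<c}. ennreal (t powr (r - 1)) \<partial>lborel"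
  have "ennreal (c powr r / r) = (\<integral>\<^sup>+t\<in>{0<..<c}. ennreal (t powr (r - 1)) \<partial>lborel)"
    using assms by (simp add: nn_integral_powr_Ioo)
  also have "\<dots> = (\<integral>\<^sup>+t. ennreal (t powr (r - 1)) * indicator {0<..<a} t
      + ennreal (t powr (r - 1)) * indicator {a..<c} t \<partial>lborel)"
    using assms by (intro nn_integral_cong) (auto simp: indicator_def)
  also have "\<dots> = ennreal (a powr r / r) + ?X"
    using assms by (simp add: nn_integral_add nn_integral_powr_Ioo)
  \<comment> \<open>The first summand is finite, so it can be cancelled in
    \<open>ennreal\<close>.\<close>
  finally have "ennreal (a powr r / r) + ?X = ennreal (c powr r / r)" by simp
  then show ?thesis
    using assms
    by (cases ?X) (auto simp: ennreal_plus[symmetric] diff_divide_distrib simp del: ennreal_plus)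
qed

text \<open>On annulus \<open>k\<close> the norm is at least \<open>2 ^ k\<close>, so the weight is
  at most \<open>2 powr (- b * k)\<close>.\<close>

lemma nn_integral_dyadic_step_weighted_le:
  fixes c :: "nat \<Rightarrow> real"
  assumes c: "\<And>k. c k \<ge> 0" and b: "b \<ge> 0"
  shows "(\<integral>\<^sup>+x. ennreal (\<bar>(dyadic_step c :: 'a::euclidean_space \<Rightarrow> real) x\<bar> powr r / norm x powr b) \<partial>lebesgue)
    \<le> (\<Sum>k. ennreal (c k powr r * 2 powr (- b * k)) * emeasure lebesgue (dyadic_annulus k :: 'a set))"
proof -
  have "(\<integral>\<^sup>+x. ennreal (\<bar>(dyadic_step c :: 'a \<Rightarrow> real) x\<bar> powr r / norm x powr b) \<partial>lebesgue)
      \<le> (\<integral>\<^sup>+x. (\<Sum>k. ennreal (c k powr r * 2 powr (- b * k)) * indicator (dyadic_annulus k) (x::'a)) \<partial>lebesgue)"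
  proof (rule nn_integral_mono)
    fix x :: 'a
    let ?g = "\<lambda>k. ennreal (c k powr r * 2 powr (- b * k)) * indicator (dyadic_annulus k) x"
    show "ennreal (\<bar>dyadic_step c x\<bar> powr r / norm x powr b) \<le> (\<Sum>k. ?g k)"
    proof (cases "norm x < 1")
      case True
      then show ?thesis by (simp add: dyadic_step_def)
    next
      case False
      then obtain k where k: "x \<in> dyadic_annulus k"
        using dyadic_annulus_cover[of x] by (auto simp: not_less)
      have "x \<noteq> 0" using False by auto
      have "2 powr (b * k) = (2 ^ k) powr b"
        by (simp add: powr_realpow[symmetric] powr_powr mult.commute)
      also have "\<dots> \<le> norm x powr b"
        using k b by (intro powr_mono2) (auto simp: dyadic_annulus_def)
      finally have "c k powr r / norm x powr b \<le> c k powr r / 2 powr (b * k)"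
        by (intro divide_left_mono) (use \<open>x \<noteq> 0\<close> in auto)
      then have "ennreal (\<bar>dyadic_step c x\<bar> powr r / norm x powr b) \<le> ?g k"
        using k c by (auto simp: dyadic_step_annulus[OF k] powr_minus_divide intro!: ennreal_leI)
      also have "?g k = sum ?g {k}"
        by (simp only: sum.insert sum.empty finite.emptyI empty_iff add_0_right not_False_eq_True)
      also have "\<dots> \<le> (\<Sum>k. ?g k)"
        by (rule sum_le_suminf) auto
      finally show ?thesis .
    qed
  qed
  also have "\<dots> = (\<Sum>k. ennreal (c k powr r * 2 powr (- b * k)) * emeasure lebesgue (dyadic_annulus k :: 'a set))"
    by (subst nn_integral_suminf)
       (auto simp: nn_integral_cmult_indicator simp del: emeasure_completion)
  finally show ?thesis .
qed

text \<open>For heights between \<open>c (Suc k)\<close> and \<open>c k\<close> the superlevel set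
  contains annulus \<open>k\<close>. Keeping only this annulus and integrating over these disjoint
  height ranges gives the series.\<close>

lemma nn_integral_dyadic_step_Lorentz_ge:
  fixes c :: "nat \<Rightarrow> real"
  assumes pos: "\<And>k. c k > 0" and dec: "antimono c" and P: "P > 0" and q: "q > 0"
  shows "(\<Sum>k. ennreal_powr (emeasure lebesgue (dyadic_annulus k :: 'a::euclidean_space set)) (q / P)
        * ennreal ((c k powr q - c (Suc k) powr q) / q))
    \<le> (\<integral>\<^sup>+t\<in>{0<..}. ennreal (t powr (q - 1))
        * ennreal_powr (distribution_function (dyadic_step c :: 'a \<Rightarrow> real) t) (q / P) \<partial>lborel)"
proof -
  define v where "v k = ennreal_powr (emeasure lebesgue (dyadic_annulus k :: 'a set)) (q / P)" for k
  \<comment> \<open>Half-open on the right: superlevel sets are strict, so at height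
    \<open>c k\<close> annulus \<open>k\<close> is no longer included.\<close>
  define I where "I k = {c (Suc k)..<c k}" for k
  let ?m = "distribution_function (dyadic_step c :: 'a \<Rightarrow> real)"
  have disj: "disjoint_family I"
    unfolding disjoint_family_on_def
  proof (intro ballI impI, rule ccontr)
    fix i j :: nat assume "i \<noteq> j" "I i \<inter> I j \<noteq> {}"
    then obtain t where t: "t \<in> I i" "t \<in> I j" by blast
    have "c j \<le> c (Suc i)" if "i < j" using dec that by (auto simp: antimono_def)
    moreover have "c i \<le> c (Suc j)" if "j < i" using dec that by (auto simp: antimono_def)
    ultimately show False using t \<open>i \<noteq> j\<close> by (auto simp: I_def neq_iff)
  qed
  have ge: "v k \<le> ennreal_powr (?m t) (q / P)" if "t \<in> I k" for t k
  proof -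
    have "{x \<in> space lebesgue. t < \<bar>dyadic_step c x\<bar>} \<in> sets (lebesgue :: 'a measure)" by measurable
    moreover have "dyadic_annulus k \<subseteq> {x :: 'a. t < \<bar>dyadic_step c x\<bar>}"
      using that by (auto simp: dyadic_step_annulus I_def)
    ultimately show ?thesis
      unfolding v_def distribution_function_def using P q
      by (intro ennreal_powr_mono emeasure_mono) auto
  qed
  have "v k * ennreal ((c k powr q - c (Suc k) powr q) / q)
      = (\<integral>\<^sup>+t. v k * ennreal (t powr (q - 1)) * indicator (I k) t \<partial>lborel)" for k
  proof -
    have "c (Suc k) \<le> c k" using dec by (simp add: antimono_def)
    then show ?thesis
      using nn_integral_powr_Ico[of "c (Suc k)" "c k" q] pos q
      by (simp add: I_def mult.assoc nn_integral_cmult)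
  qed
  then have "(\<Sum>k. v k * ennreal ((c k powr q - c (Suc k) powr q) / q))
      = (\<integral>\<^sup>+t. (\<Sum>k. v k * ennreal (t powr (q - 1)) * indicator (I k) t) \<partial>lborel)"
    by (simp add: nn_integral_suminf I_def)
  also have "\<dots> \<le> (\<integral>\<^sup>+t\<in>{0<..}. ennreal (t powr (q - 1)) * ennreal_powr (?m t) (q / P) \<partial>lborel)"
  proof (rule nn_integral_mono)
    fix t :: real
    show "(\<Sum>k. v k * ennreal (t powr (q - 1)) * indicator (I k) t)
      \<le> ennreal (t powr (q - 1)) * ennreal_powr (?m t) (q / P) * indicator {0<..} t"
    proof (cases "\<exists>k. t \<in> I k")
      case True
      then obtain k where k: "t \<in> I k" by blast
      then have "t > 0" using pos[of "Suc k"] by (auto simp: I_def)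
      have "(\<Sum>k. v k * ennreal (t powr (q - 1)) * indicator (I k) t) = v k * ennreal (t powr (q - 1))"
        by (rule suminf_cmult_indicator[OF disj k])
      also have "\<dots> \<le> ennreal (t powr (q - 1)) * ennreal_powr (?m t) (q / P)"
        using ge[OF k] by (subst mult.commute) (rule mult_left_mono, auto)
      finally show ?thesis using \<open>t > 0\<close> by simp
    qed simp
  qed
  finally show ?thesis unfolding v_def .
qed

section \<open>A function showing that the inclusion is strict\<close>

lemma ex_weighted_Lebesgue_not_Lorentz:
  fixes a p q r :: real
  assumes b: "b = 2 * a * r / p" "0 \<le> b" "b < DIM('a)" and q: "0 < q" "q < r"
    and P: "P = r / (1 - b / DIM('a))"
  obtains u :: "'a::euclidean_space \<Rightarrow> real"
    where "u \<in> weighted_Lebesgue_space a p r" "u \<notin> Lorentz_space P q"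
proof -
  define n where "n = real DIM('a)"
  have n: "n > 0" by (simp add: n_def)
  \<comment> \<open>The identity \<open>nP\<close> is the scaling balance between decay, weight and
    volume that makes the powers of 2 cancel below.\<close>
  have "P > 0" and nP: "n * r / P = n - b"
    using b(2,3) q by (simp_all add: P n_def field_simps)
  define V where "V = unit_ball_vol n * (2 ^ DIM('a) - 1)"
  have "(1::real) < 2 ^ DIM('a)" by (intro one_less_power) auto
  then have V: "V > 0" by (simp add: V_def n_def)
  have vol: "emeasure lebesgue (dyadic_annulus k :: 'a set) = ennreal (V * 2 powr (k * n))" for k
    by (simp add: emeasure_dyadic_annulus V_def n_def del: emeasure_completion)
  \<comment> \<open>The geometric factor offsets the growth of the volumes. The exponent
    \<open>- 1 / q\<close> is borderline: the \<open>q\<close>-th power of the second factor is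
    harmonic, while its \<open>r\<close>-th power is summable as \<open>r > q\<close>.\<close>
  define c where "c k = 2 powr (- (k * n / P)) * (1 + real k) powr (- 1 / q)" for k :: nat
  have pos: "c k > 0" for k by (simp add: c_def)
  have dec: "antimono c"
    unfolding antimono_def c_def using \<open>P > 0\<close> n q
    by (auto intro!: mult_mono powr_mono powr_mono2' divide_right_mono mult_right_mono)
  have upper: "c k powr r * 2 powr (- b * k) * (V * 2 powr (k * n)) = V * real (Suc k) powr (- r / q)" for k
  proof -
    have "- (k * n / P) * r + - b * k + k * n = k * (n - b - n * r / P)"
      by (simp add: algebra_simps)
    also have "\<dots> = 0" by (simp add: nP)
    finally have "2 powr (- (k * n / P) * r) * 2 powr (- b * k) * 2 powr (k * n) = 1"
      by (simp only: powr_add[symmetric]) simp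
    then show ?thesis
      by (simp add: c_def powr_mult powr_powr add.commute mult_ac)
  qed
  have "(\<integral>\<^sup>+x. ennreal (\<bar>(dyadic_step c :: 'a \<Rightarrow> real) x\<bar> powr r / norm x powr b) \<partial>lebesgue)
      \<le> (\<Sum>k. ennreal (c k powr r * 2 powr (- b * k)) * emeasure lebesgue (dyadic_annulus k :: 'a set))"
    using b q less_imp_le[OF pos] by (intro nn_integral_dyadic_step_weighted_le) auto
  also have "\<dots> = (\<Sum>k. ennreal (V * real (Suc k) powr (- r / q)))"
    unfolding vol upper[symmetric] using V by (simp only: ennreal_mult' less_imp_le mult_nonneg_nonneg powr_ge_zero)
  also have "\<dots> < \<infinity>"
  proof -
    have "summable (\<lambda>k. real k powr (- r / q))"
      using q by (subst summable_real_powr_iff) (simp add: field_simps)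
    then have "summable (\<lambda>k. V * real (Suc k) powr (- r / q))"
      using summable_Suc_iff[of "\<lambda>k. real k powr (- r / q)"] by (intro summable_mult) blast
    then show ?thesis
      using V by (simp add: less_top[symmetric] ennreal_suminf_neq_top del: of_nat_Suc)
  qed
  finally have "(dyadic_step c :: 'a \<Rightarrow> real) \<in> weighted_Lebesgue_space a p r"
    by (simp add: weighted_Lebesgue_space_def weighted_Lebesgue_norm_def b(1))
  moreover have "(dyadic_step c :: 'a \<Rightarrow> real) \<notin> Lorentz_space P q"
  proof
    assume "(dyadic_step c :: 'a \<Rightarrow> real) \<in> Lorentz_space P q"
    then have fin: "(\<integral>\<^sup>+t\<in>{0<..}. ennreal (t powr (q - 1))
        * ennreal_powr (distribution_function (dyadic_step c :: 'a \<Rightarrow> real) t) (q / P) \<partial>lborel) < \<infinity>"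
      using \<open>P > 0\<close> by (simp add: Lorentz_space_iff)
    \<comment> \<open>\<open>2 powr (k * d)\<close> is the growth of the annulus volume raised to
      \<open>q / P\<close>, and \<open>2 powr (- (k * d))\<close> the geometric decay of
      \<open>c k powr q\<close>.\<close>
    define d where "d = n * q / P"
    have "d > 0" using n q \<open>P > 0\<close> by (simp add: d_def)
    \<comment> \<open>The factor \<open>1 - 2 powr (- d)\<close> is the relative drop of the
      geometric part from one annulus to the next; \<open>V powr (q / P)\<close> and
      \<open>1 / q\<close> come from the volume and the power integral.\<close>
    define D where "D = V powr (q / P) * (1 - 2 powr (- d)) / q"
    have "2 powr (- d) < 1" using \<open>d > 0\<close> powr_less_mono[of "- d" 0 2] by simp
    then have "D > 0" using V q by (simp add: D_def)
    have cq: "c k powr q = 2 powr (- (k * d)) / Suc k" for k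
    proof -
      have "- (k * n / P) * q = - (k * d)" "- 1 / q * q = - 1"
        using q by (simp_all add: d_def)
      then have "c k powr q = 2 powr (- (k * d)) * (1 + real k) powr (- 1)"
        by (simp only: c_def powr_mult powr_powr)
      then show ?thesis by (simp add: powr_minus_divide add.commute)
    qed
    have lower: "D / Suc k \<le> (V * 2 powr (k * n)) powr (q / P) * ((c k powr q - c (Suc k) powr q) / q)" for k
    proof -
      \<comment> \<open>Enlarging \<open>1 / Suc (Suc k)\<close> to \<open>1 / Suc k\<close> gives
        both terms of the difference the same harmonic factor.\<close>
      have "c (Suc k) powr q \<le> 2 powr (- (Suc k * d)) / Suc k"
        unfolding cq by (intro divide_left_mono) auto
      also have "2 powr (- (Suc k * d)) = 2 powr (- (k * d)) * 2 powr (- d)"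
        by (simp add: powr_add[symmetric] algebra_simps)
      finally have "2 powr (- (k * d)) * ((1 - 2 powr (- d)) / Suc k) \<le> c k powr q - c (Suc k) powr q"
        unfolding cq[of k] by (simp add: algebra_simps diff_divide_distrib)
      then have "2 powr (k * d) * (2 powr (- (k * d)) * ((1 - 2 powr (- d)) / Suc k))
          \<le> 2 powr (k * d) * (c k powr q - c (Suc k) powr q)"
        by (rule mult_left_mono) simp
      moreover have "2 powr (k * d) * 2 powr (- (k * d)) = 1"
        by (simp add: powr_minus)
      ultimately have "(1 - 2 powr (- d)) / Suc k \<le> 2 powr (k * d) * (c k powr q - c (Suc k) powr q)"
        by (simp only: mult.assoc[symmetric] mult_1_left)
      then have "V powr (q / P) / q * ((1 - 2 powr (- d)) / Suc k)
          \<le> V powr (q / P) / q * (2 powr (k * d) * (c k powr q - c (Suc k) powr q))"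
        using q by (intro mult_left_mono) auto
      moreover have "(V * 2 powr (k * n)) powr (q / P) = V powr (q / P) * 2 powr (k * d)"
        by (simp add: powr_mult powr_powr d_def mult.assoc)
      ultimately show ?thesis
        by (simp add: D_def mult_ac del: of_nat_Suc)
    qed
    have "(\<Sum>k. ennreal (D / Suc k)) \<le> (\<Sum>k. ennreal_powr (emeasure lebesgue (dyadic_annulus k :: 'a set)) (q / P)
        * ennreal ((c k powr q - c (Suc k) powr q) / q))"
    proof (rule suminf_le)
      fix k
      show "ennreal (D / Suc k) \<le> ennreal_powr (emeasure lebesgue (dyadic_annulus k :: 'a set)) (q / P)
          * ennreal ((c k powr q - c (Suc k) powr q) / q)"
        using ennreal_leI[OF lower[of k]] V unfolding vol
        by (simp only: ennreal_powr_ennreal ennreal_mult'[symmetric] powr_ge_zero mult_nonneg_nonneg less_imp_le)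
    qed auto
    also have "\<dots> < \<infinity>"
      using nn_integral_dyadic_step_Lorentz_ge[where 'a='a, OF pos dec \<open>P > 0\<close> q(1)] fin
      by (rule order.strict_trans1)
    finally have "summable (\<lambda>k. D / Suc k)"
      using \<open>D > 0\<close> by (intro summable_suminf_not_top) (auto simp: less_top)
    then have "summable (\<lambda>k. inverse (real (Suc k)))"
      using \<open>D > 0\<close> summable_mult[of "\<lambda>k. D / Suc k" "1 / D"]
      by (simp add: inverse_eq_divide del: of_nat_Suc)
    then show False
      using not_summable_harmonic[where 'a=real] summable_Suc_iff[of "\<lambda>k. inverse (real k)"] by blast
  qed
  ultimately show ?thesis by (rule that)
qed

section \<open>Matching the exponents of the theorem\<close>

theorem proposition5p3:
  fixes N :: nat and s \<sigma> p a p_star p_star_s :: real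
  assumes "N = CARD('n::finite)" and "N \<ge> 2"
    and "1 < s" and "s < 2" and "\<sigma> = s - 1"
    and "1 < p" and "p < real N / s"
    and "0 \<le> a" and "a < (real N - s * p) / 2"
    and "p_star = real N * p / (real N - s * p - 2 * a)"
    and "p_star_s = real N * p / (real N - s * p)"
  shows "(Lorentz_space p_star p :: (real ^ 'n \<Rightarrow> real) set)
           \<subset> weighted_Lebesgue_space a p p_star_s"
proof -
  define b where "b = 2 * a * p_star_s / p"
  define \<delta> where "\<delta> = real N - s * p"
  have \<delta>: "\<delta> > 2 * a" "\<delta> > 0" "\<delta> < N"
    using assms by (auto simp: \<delta>_def)
  have N: "real N > 0" "DIM(real ^ 'n) = N"
    using assms by auto
  have b_eq: "b = 2 * a * N / \<delta>"
    using assms(6,11) by (simp add: b_def \<delta>_def)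
  \<comment> \<open>By \<open>b_eq\<close>, \<open>b < N\<close> amounts to
    \<open>2 * a < \<delta>\<close>, which is the upper bound on \<open>a\<close>.\<close>
  have b: "0 \<le> b" "b < DIM(real ^ 'n)"
    using \<delta> N assms(8) by (auto simp: b_eq field_simps)
  \<comment> \<open>\<open>p_star_s\<close> is \<open>p\<close> times \<open>N / \<delta>\<close>,
    and this ratio exceeds 1.\<close>
  have p: "0 < p" "p < p_star_s"
    using assms(6) mult_strict_left_mono[OF \<delta>(3), of p] \<delta>(2)
    unfolding assms(11) \<delta>_def[symmetric] by (simp_all add: pos_less_divide_eq mult.commute)
  \<comment> \<open>Dividing \<open>p_star_s = N * p / \<delta>\<close> by this ratio replaces
    \<open>\<delta>\<close> by \<open>\<delta> - 2 * a\<close>, which gives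
    \<open>p_star\<close>.\<close>
  have "1 - b / N = (\<delta> - 2 * a) / \<delta>"
    using \<delta> N by (simp add: b_eq field_simps)
  then have P: "p_star = p_star_s / (1 - b / DIM(real ^ 'n))"
    using \<delta> N(2) assms(10,11) by (simp add: \<delta>_def[symmetric])
  obtain u :: "real ^ 'n \<Rightarrow> real" where "u \<in> weighted_Lebesgue_space a p p_star_s" "u \<notin> Lorentz_space p_star p"
    using ex_weighted_Lebesgue_not_Lorentz[OF b_def b p P] .
  then show ?thesis
    using Lorentz_space_subset_weighted_Lebesgue_space[OF b_def b p P] by blast
qed

end
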